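(* Let $n,m\ge1$. There exists a set $X\subset\mathbb{T}^d$ with $d=nm(m+1)/2$ such that every stratum of $X$ is a finite union of hyperplanes and such that, for every sequence $Q^{(1)},\dots,Q^{(n)}\in\mathbb{T}_\pm^{m\times m}$ of symmetric tropical Metzler matrices, if the vector with entries $|Q^{(k)}_{ij}|$ ($k\in[n]$, $1\le i\le j\le m$) does not belong to $X$, then the hypergraph $\vec{\mathcal{G}}_x$ associated with $Q^{(1)},\dots,Q^{(n)}$ and $x$ does not admit a circulation for any $x\in\mathbb{R}^n$.
   Context: $[k]=\{1,\dots,k\}$. $\mathbb{T}=\mathbb{R}\cup\{-\infty\}$ with its usual order and addition ($-\infty$ absorbing). $\mathbb{T}_\pm$ is the set of signed tropical numbers: pairs $(1,a)$ (written $a$; the set of these is $\mathbb{T}_+$), pairs $(-1,a)$ (written $\ominus a$; the set of these is $\mathbb{T}_-$), with $a\in\mathbb{R}$, and $-\infty$ (sign $0$). Modulus: $|a|=|\ominus a|=a$ and $|-\infty|=-\infty$. A matrix over $\mathbb{T}_\pm$ is tropical Metzler if its off-diagonal entries lie in $\mathbb{T}_-\cup\{-\infty\}$. A (directed) hypergraph is a pair $(V,E)$ with $V$ a finite set of vertices and $E$ a finite set of edges, each edge $e$ being a pair $(T_e,h_e)$ where $h_e\in V$ is the head and $T_e$ is a multiset of elements of $V$ (the tails); $|T_e|$ is its cardinality with multiplicity, and $h_e\in T_e$ is allowed. $\mathrm{In}(v)$ is the set of edges with head $v$; $\mathrm{Out}(v)$ is the multiset of edges $e$ with $v\in T_e$,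 where $e$ appears $p$ times if $v$ appears $p$ times in $T_e$. A circulation is a nonzero vector $\gamma=(\gamma_e)_{e\in E}$ with $\gamma_e\ge0$ for all $e$ (normalized so that $\sum_e\gamma_e=1$) and $\sum_{e\in\mathrm{In}(v)}|T_e|\gamma_e=\sum_{e\in\mathrm{Out}(v)}\gamma_e$ for all $v\in V$. For $x\in\mathbb{R}^n$ let $Q^+_{ii}(x)=\max\{Q^{(k)}_{ii}+x_k:Q^{(k)}_{ii}\in\mathbb{T}_+\}$, $Q^-_{ii}(x)=\max\{|Q^{(k)}_{ii}|+x_k:Q^{(k)}_{ii}\in\mathbb{T}_-\}$ and, for $i\ne j$, $|Q_{ij}(x)|=\max\{|Q^{(k)}_{ij}|+x_k:Q^{(k)}_{ij}\neq-\infty\}$, with $\max\emptyset=-\infty$. In each case "maximizer" means an index $k$ among those over which the maximum is taken that attains it. The hypergraph $\vec{\mathcal{G}}_x$ has vertex set $[n]$ and the following edges: for every $i\in[m]$ with $Q^+_{ii}(x)=Q^-_{ii}(x)\neq-\infty$, every maximizer $k$ of $Q^+_{ii}(x)$ and every maximizer $l$ of $Q^-_{ii}(x)$, an edge $(\{k\},l)$; for every $i<j$ with $Q^+_{ii}(x)+Q^+_{jj}(x)=2|Q_{ij}(x)|\neq-\infty$, every maximizer $k_1$ of $Q^+_{ii}(x)$, every maximizer $k_2$ of $Q^+_{jj}(x)$ and every maximizer $l$ of $|Q_{ij}(x)|$, an edge $(\{k_1,k_2\},l)$ (a multiset of two tails). The support of $z\in\mathbb{T}^d$ is $\{r: z_r\ne-\infty\}$.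 For nonempty $D\subset[d]$, the stratum of $X\subset\mathbb{T}^d$ associated with $D$ is the set of $(z_r)_{r\in D}\in\mathbb{R}^D$ for $z\in X$ with support exactly $D$. A hyperplane of $\mathbb{R}^D$ is an affine subspace of codimension one; a finite union of hyperplanes may be empty. *)

theory Defs
  imports "HOL-Analysis.Analysis" "HOL-Library.Multiset"
begin

definition trop :: "ereal set" where
  "trop = {t. t \<noteq> \<infinity>}"

text \<open>\<open>TPos a\<close> is the pair $(1,a)$, \<open>TNeg a\<close> the pair $(-1,a)$, and \<open>TZero\<close> is $-\infty$.\<close>

datatype signed_trop = TPos real | TNeg real | TZero

definition trop_pos :: "signed_trop set" where
  "trop_pos = range TPos"

definition trop_neg :: "signed_trop set" where
  "trop_neg = range TNeg"

fun modulus :: "signed_trop \<Rightarrow> ereal" where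
  "modulus (TPos a) = ereal a"
| "modulus (TNeg a) = ereal a"
| "modulus TZero = -\<infinity>"

type_synonym ('a, 'm) sq_matrix = "'a^'m^'m"

definition tropical_metzler :: "(signed_trop, 'm::finite) sq_matrix \<Rightarrow> bool" where
  "tropical_metzler A \<longleftrightarrow> (\<forall>i j. i \<noteq> j \<longrightarrow> A $ i $ j \<in> trop_neg \<union> {TZero})"

type_synonym 'v hyperedge = "'v multiset \<times> 'v"
type_synonym 'v hypergraph = "'v set \<times> 'v hyperedge set"

definition in_edges :: "'v hyperedge set \<Rightarrow> 'v \<Rightarrow> 'v hyperedge set" where
  "in_edges E v = {e \<in> E. snd e = v}"

definition out_edges :: "'v hyperedge set \<Rightarrow> 'v \<Rightarrow> 'v hyperedge multiset" where
  "out_edges E v = (\<Sum>e\<in>E. replicate_mset (count (fst e) v) e)"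

fun circulation :: "'v hypergraph \<Rightarrow> ('v hyperedge \<Rightarrow> real) \<Rightarrow> bool" where
  "circulation (V, E) \<gamma> \<longleftrightarrow>
     (\<forall>e\<in>E. 0 \<le> \<gamma> e) \<and> (\<Sum>e\<in>E. \<gamma> e) = 1 \<and>
     (\<forall>v\<in>V. (\<Sum>e\<in>in_edges E v. real (size (fst e)) * \<gamma> e) = (\<Sum>e\<in>#out_edges E v. \<gamma> e))"

text \<open>Inserting $-\infty$ encodes $\max\emptyset=-\infty$ and changes no other maximum.\<close>

definition max_over ::
  "('n::finite \<Rightarrow> (signed_trop, 'm::finite) sq_matrix) \<Rightarrow> real^'n \<Rightarrow> 'n set \<Rightarrow> 'm \<Rightarrow> 'm \<Rightarrow> ereal" where
  "max_over Q x K i j = Max (insert (-\<infinity>) ((\<lambda>k. modulus (Q k $ i $ j) + ereal (x $ k)) ` K))"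

definition maximizers_over ::
  "('n::finite \<Rightarrow> (signed_trop, 'm::finite) sq_matrix) \<Rightarrow> real^'n \<Rightarrow> 'n set \<Rightarrow> 'm \<Rightarrow> 'm \<Rightarrow> 'n set" where
  "maximizers_over Q x K i j =
     {k \<in> K. modulus (Q k $ i $ j) + ereal (x $ k) = max_over Q x K i j}"

definition pos_ind :: "('n \<Rightarrow> (signed_trop, 'm::finite) sq_matrix) \<Rightarrow> 'm \<Rightarrow> 'n set" where
  "pos_ind Q i = {k. Q k $ i $ i \<in> trop_pos}"

definition neg_ind :: "('n \<Rightarrow> (signed_trop, 'm::finite) sq_matrix) \<Rightarrow> 'm \<Rightarrow> 'n set" where
  "neg_ind Q i = {k. Q k $ i $ i \<in> trop_neg}"

definition off_ind :: "('n \<Rightarrow> (signed_trop, 'm::finite) sq_matrix) \<Rightarrow> 'm \<Rightarrow> 'm \<Rightarrow> 'n set" where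
  "off_ind Q i j = {k. Q k $ i $ j \<noteq> TZero}"

abbreviation Qpos :: "('n::finite \<Rightarrow> (signed_trop, 'm::finite) sq_matrix) \<Rightarrow> real^'n \<Rightarrow> 'm \<Rightarrow> ereal" where
  "Qpos Q x i \<equiv> max_over Q x (pos_ind Q i) i i"

abbreviation Qneg :: "('n::finite \<Rightarrow> (signed_trop, 'm::finite) sq_matrix) \<Rightarrow> real^'n \<Rightarrow> 'm \<Rightarrow> ereal" where
  "Qneg Q x i \<equiv> max_over Q x (neg_ind Q i) i i"

abbreviation Qoff :: "('n::finite \<Rightarrow> (signed_trop, 'm::finite) sq_matrix) \<Rightarrow> real^'n \<Rightarrow> 'm \<Rightarrow> 'm \<Rightarrow> ereal" where
  "Qoff Q x i j \<equiv> max_over Q x (off_ind Q i j) i j"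

abbreviation argQpos :: "('n::finite \<Rightarrow> (signed_trop, 'm::finite) sq_matrix) \<Rightarrow> real^'n \<Rightarrow> 'm \<Rightarrow> 'n set" where
  "argQpos Q x i \<equiv> maximizers_over Q x (pos_ind Q i) i i"

abbreviation argQneg :: "('n::finite \<Rightarrow> (signed_trop, 'm::finite) sq_matrix) \<Rightarrow> real^'n \<Rightarrow> 'm \<Rightarrow> 'n set" where
  "argQneg Q x i \<equiv> maximizers_over Q x (neg_ind Q i) i i"

abbreviation argQoff :: "('n::finite \<Rightarrow> (signed_trop, 'm::finite) sq_matrix) \<Rightarrow> real^'n \<Rightarrow> 'm \<Rightarrow> 'm \<Rightarrow> 'n set" where
  "argQoff Q x i j \<equiv> maximizers_over Q x (off_ind Q i j) i j"

text \<open>A finite linear order \<open>'m\<close> plays the role of $[m]$, since edges and coordinates refer to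
  pairs $i<j$ and $i\le j$; a finite type \<open>'n\<close> plays the role of $[n]$.\<close>

definition tropical_edges ::
  "('n::finite \<Rightarrow> (signed_trop, 'm::{finite,linorder}) sq_matrix) \<Rightarrow> real^'n \<Rightarrow> 'n hyperedge set" where
  "tropical_edges Q x =
     {({#k#}, l) | i k l. Qpos Q x i = Qneg Q x i \<and> Qpos Q x i \<noteq> -\<infinity> \<and>
        k \<in> argQpos Q x i \<and> l \<in> argQneg Q x i} \<union>
     {({#k1, k2#}, l) | i j k1 k2 l. i < j \<and>
        Qpos Q x i + Qpos Q x j = 2 * Qoff Q x i j \<and> 2 * Qoff Q x i j \<noteq> -\<infinity> \<and>
        k1 \<in> argQpos Q x i \<and> k2 \<in> argQpos Q x j \<and> l \<in> argQoff Q x i j}"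

definition tropical_hypergraph ::
  "('n::finite \<Rightarrow> (signed_trop, 'm::{finite,linorder}) sq_matrix) \<Rightarrow> real^'n \<Rightarrow> 'n hypergraph" where
  "tropical_hypergraph Q x = (UNIV, tropical_edges Q x)"

lemma finite_tropical_edges: "finite (tropical_edges Q x)"
proof (rule finite_subset)
  show "tropical_edges Q x \<subseteq>
      range (\<lambda>(k, l). ({#k#}, l)) \<union> range (\<lambda>(k1, k2, l). ({#k1, k2#}, l))"
    unfolding tropical_edges_def by (force simp: image_iff)
qed simp

text \<open>Coordinates of the vector of moduli: triples \<open>(k, i, j)\<close> with \<open>i \<le> j\<close>. The dimension
  $d = nm(m+1)/2$ is the cardinality of this type, see \<open>card_sym_index\<close> below.\<close>

typedef (overloaded) ('n, 'm::linorder) sym_index = "{(k :: 'n, i :: 'm, j :: 'm). i \<le> j}"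
  by auto

instance sym_index :: (finite, "{finite,linorder}") finite
proof
  have "(UNIV :: ('a, 'b) sym_index set) = Abs_sym_index ` {(k, i, j). i \<le> j}"
    using type_definition.Abs_image[OF type_definition_sym_index] by metis
  then show "finite (UNIV :: ('a, 'b) sym_index set)"
    by (metis finite finite_imageI)
qed

lemma card_sym_index:
  "CARD(('n::finite, 'm::{finite,linorder}) sym_index) = CARD('n) * CARD('m) * (CARD('m) + 1) div 2"
proof -
  let ?L = "{(i :: 'm, j). i \<le> j}" and ?U = "{(i :: 'm, j). j \<le> i}"
  have "?U = prod.swap ` ?L" by (auto simp: image_iff)
  then have eq: "card ?U = card ?L" by (simp add: card_image)
  have "?L \<union> ?U = UNIV" by auto
  moreover have "?L \<inter> ?U = range (\<lambda>i. (i, i))" by auto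
  moreover have "card (range (\<lambda>i :: 'm. (i, i))) = CARD('m)" by (simp add: card_image inj_on_def)
  moreover have "card ?L + card ?U = card (?L \<union> ?U) + card (?L \<inter> ?U)"
    by (rule card_Un_Int) auto
  ultimately have L: "2 * card ?L = CARD('m) * (CARD('m) + 1)"
    using eq by (simp flip: UNIV_Times_UNIV add: card_cartesian_product)
  have "CARD(('n, 'm) sym_index) = card {(k :: 'n, i :: 'm, j). i \<le> j}"
    by (rule type_definition.card[OF type_definition_sym_index])
  also have "{(k :: 'n, i :: 'm, j). i \<le> j} = UNIV \<times> ?L" by auto
  finally have "2 * CARD(('n, 'm) sym_index) = CARD('n) * (2 * card ?L)"
    by (simp add: card_cartesian_product)
  then have "2 * CARD(('n, 'm) sym_index) = CARD('n) * CARD('m) * (CARD('m) + 1)"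
    unfolding L by (simp only: mult.assoc)
  then show ?thesis by simp
qed

definition moduli ::
  "('n::finite \<Rightarrow> (signed_trop, 'm::{finite,linorder}) sq_matrix) \<Rightarrow> ereal^('n, 'm) sym_index" where
  "moduli Q = (\<chi> r. case Rep_sym_index r of (k, i, j) \<Rightarrow> modulus (Q k $ i $ j))"

definition trop_support :: "ereal^'d \<Rightarrow> 'd set" where
  "trop_support z = {r. z $ r \<noteq> -\<infinity>}"

text \<open>As \<open>D\<close> varies, $\mathbb{R}^D$ is represented by the coordinate subspace of $\mathbb{R}^d$ of
  the vectors vanishing outside \<open>D\<close>; vectors indexed by \<open>D\<close> are extended by zero.\<close>

definition coord_space :: "'d::finite set \<Rightarrow> (real^'d) set" where
  "coord_space D = {y. \<forall>r. r \<notin> D \<longrightarrow> y $ r = 0}"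

definition stratum :: "(ereal^'d::finite) set \<Rightarrow> 'd set \<Rightarrow> (real^'d) set" where
  "stratum X D = {(\<chi> r. if r \<in> D then real_of_ereal (z $ r) else 0) | z.
     z \<in> X \<and> trop_support z = D}"

definition hyperplane_of :: "'d::finite set \<Rightarrow> (real^'d) set \<Rightarrow> bool" where
  "hyperplane_of D H \<longleftrightarrow>
     affine H \<and> H \<subseteq> coord_space D \<and> aff_dim H = aff_dim (coord_space D) - 1"

end

theory Submission
  imports Defs
begin

text \<open>
Every hyperedge of the tropical hypergraph witnesses a tie between maxima, that is, a linear
relation between two or three of the moduli and the coordinates of \<open>x\<close>: the (shifted) moduli at its
two tails sum to twice the one at its head, where an edge with a single tail counts that tail
twice.  A circulation is a way of combining these relations with nonnegative weights such that \<open>x\<close>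
cancels (\<open>circulation_imp_balanced_form\<close>, \<open>balanced_form_vanishes\<close>).  What remains is a linear
relation between the moduli alone.  It is nontrivial: tails are positive diagonal entries while
heads are negative diagonal or off-diagonal entries, so no coordinate occurs with both signs
(\<open>balanced_form_nonzero\<close>).  A matrix sequence with a circulation therefore has its vector of moduli
on a hyperplane.

Only finitely many hyperplanes occur, because the coefficients of the relation can be chosen
depending only on which entries of the matrices give the tails and heads of the edges, and there
are finitely many such patterns.  The exceptional set consists of the tropical points at which one
of the chosen forms is defined, its coordinates being finite, and vanishes.  On the stratum of \<open>D\<close>
precisely the forms supported in \<open>D\<close> contribute, each of them a hyperplane of the coordinate space.
\<close>

section \<open>Coordinate hyperplanes and their union\<close>

lemma subspace_coord_space: "subspace (coord_space D)"
  by (auto simp: subspace_def coord_space_def)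

lemma hyperplane_of_orthogonal_complement:
  fixes c :: "real^'d::finite"
  assumes c: "c \<in> coord_space D" "c \<noteq> 0"
  shows "hyperplane_of D {y \<in> coord_space D. c \<bullet> y = 0}"
proof -
  let ?H = "{y \<in> coord_space D. c \<bullet> y = 0}"
  have sub: "subspace ?H"
    using subspace_coord_space[of D] by (auto simp: subspace_def inner_add_right)
  have "span {c} \<subseteq> coord_space D"
    using c(1) subspace_coord_space[of D] by (simp add: span_minimal)
  then have "dim {y \<in> coord_space D. \<forall>x \<in> span {c}. orthogonal x y} + dim (span {c})
      = dim (coord_space D)"
    by (intro dim_subspace_orthogonal_to_vectors subspace_span subspace_coord_space)
  moreover have "{y \<in> coord_space D. \<forall>x \<in> span {c}. orthogonal x y} = ?H"
    by (auto simp: span_singleton orthogonal_def intro: span_base dest: spec[of _ 1])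
  moreover have "dim (span {c}) = 1"
    using c(2) by (simp add: dim_span)
  ultimately have "int (dim ?H) = int (dim (coord_space D)) - 1"
    by simp
  then show ?thesis
    unfolding hyperplane_of_def
    using sub subspace_coord_space[of D]
    by (auto simp: aff_dim_subspace subspace_imp_affine)
qed

text \<open>The value \<open>real_of_ereal (-\<infinity>) = 0\<close> makes \<open>finite_part\<close> agree with the extension by zero that
  \<open>stratum\<close> uses.\<close>

definition finite_part :: "ereal^'d \<Rightarrow> real^'d" where
  "finite_part z = (\<chi> r. real_of_ereal (z $ r))"

text \<open>A linear form can be evaluated at a tropical point only if all the coordinates that it
  involves are finite there.\<close>

definition trop_zeros :: "(real^'d) set \<Rightarrow> (ereal^'d::finite) set" where
  "trop_zeros C = {z. (\<forall>r. z $ r \<in> trop) \<and>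
     (\<exists>c\<in>C. (\<forall>r. c $ r \<noteq> 0 \<longrightarrow> r \<in> trop_support z) \<and> c \<bullet> finite_part z = 0)}"

lemma stratum_trop_zeros:
  "stratum (trop_zeros C) D =
     (\<Union>c\<in>C \<inter> coord_space D. {y \<in> coord_space D. c \<bullet> y = 0})" (is "?L = ?R")
proof (intro equalityI subsetI)
  fix y assume "y \<in> ?L"
  then obtain z where z: "z \<in> trop_zeros C" "trop_support z = D"
    and y: "y = (\<chi> r. if r \<in> D then real_of_ereal (z $ r) else 0)"
    by (auto simp: stratum_def)
  have "y = finite_part z"
    using z(2) by (auto simp: y finite_part_def trop_support_def vec_eq_iff)
  then show "y \<in> ?R"
    using z by (auto simp: trop_zeros_def coord_space_def finite_part_def trop_support_def)
next
  fix y assume "y \<in> ?R"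
  then obtain c where c: "c \<in> C" "c \<in> coord_space D" "y \<in> coord_space D" "c \<bullet> y = 0"
    by auto
  define z :: "ereal^'a" where "z = (\<chi> r. if r \<in> D then ereal (y $ r) else -\<infinity>)"
  have supp: "trop_support z = D"
    by (auto simp: z_def trop_support_def)
  have y: "y = (\<chi> r. if r \<in> D then real_of_ereal (z $ r) else 0)"
    using c(3) by (auto simp: z_def coord_space_def vec_eq_iff)
  have "finite_part z = y"
    using c(3) by (auto simp: z_def finite_part_def coord_space_def vec_eq_iff)
  moreover have "\<forall>r. z $ r \<in> trop"
    by (auto simp: z_def trop_def)
  ultimately have "z \<in> trop_zeros C"
    using c supp by (auto simp: trop_zeros_def coord_space_def)
  then show "y \<in> ?L"
    using supp y by (auto simp: stratum_def)
qed

lemma stratum_trop_zeros_hyperplanes: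
  assumes "finite C" "0 \<notin> C"
  shows "\<exists>\<H>. finite \<H> \<and> (\<forall>H\<in>\<H>. hyperplane_of D H) \<and> stratum (trop_zeros C) D = \<Union>\<H>"
proof (intro exI conjI)
  let ?\<H> = "(\<lambda>c. {y \<in> coord_space D. c \<bullet> y = 0}) ` (C \<inter> coord_space D)"
  show "finite ?\<H>" using assms(1) by simp
  show "\<forall>H\<in>?\<H>. hyperplane_of D H"
    using assms(2) hyperplane_of_orthogonal_complement by fastforce
  show "stratum (trop_zeros C) D = \<Union>?\<H>" by (rule stratum_trop_zeros)
qed

section \<open>Linear forms from balanced sets of arrows\<close>

text \<open>An arrow \<open>(s, t, h)\<close> records which two coordinates \<open>s\<close>, \<open>t\<close> and which coordinate \<open>h\<close> of the
  vector of moduli give the tails and the head of a hyperedge.  An edge with a single tail is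
  encoded by repeating that tail.\<close>

type_synonym 'd arrow = "'d \<times> 'd \<times> 'd"

fun arrow_form :: "'d::finite arrow \<Rightarrow> real^'d" where
  "arrow_form (s, t, h) = axis s 1 + axis t 1 - 2 *\<^sub>R axis h 1"

text \<open>The map \<open>\<pi>\<close> sends a coordinate to its vertex.  Being orthogonal to every vector that factors
  through \<open>\<pi>\<close> is the conservation law of a circulation in dual form: each vertex \<open>v\<close> yields the
  law at \<open>v\<close> when the vector is the indicator of the fibre of \<open>\<pi>\<close> over \<open>v\<close>.\<close>

definition balanced_forms :: "('d \<Rightarrow> 'n::finite) \<Rightarrow> 'd::finite arrow set \<Rightarrow> (real^'d) set" where
  "balanced_forms \<pi> S = {c. \<exists>g. c = (\<Sum>a\<in>S. g a *\<^sub>R arrow_form a) \<and>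
     (\<forall>a\<in>S. 0 \<le> g a) \<and> (\<exists>a\<in>S. 0 < g a) \<and>
     (\<forall>x :: real^'n. c \<bullet> (\<chi> r. x $ \<pi> r) = 0)}"

text \<open>If no coordinate is both a head and a tail, then the coefficient of a head collects only
  nonpositive terms, and one of them is negative.\<close>

lemma balanced_form_nonzero:
  fixes S :: "'d::finite arrow set"
  assumes c: "c \<in> balanced_forms \<pi> S"
    and disj: "\<And>s t h s' t' h'. (s, t, h) \<in> S \<Longrightarrow> (s', t', h') \<in> S \<Longrightarrow> h \<noteq> s' \<and> h \<noteq> t'"
  shows "c \<noteq> 0"
proof -
  obtain g where c_eq: "c = (\<Sum>a\<in>S. g a *\<^sub>R arrow_form a)"
    and g: "\<forall>a\<in>S. 0 \<le> g a" and ex: "\<exists>a\<in>S. 0 < g a"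
    using c by (auto simp: balanced_forms_def)
  from ex obtain s t h where a: "(s, t, h) \<in> S" "0 < g (s, t, h)" by auto
  have coeff: "arrow_form b $ h = (if snd (snd b) = h then -2 else 0)" if "b \<in> S" for b
  proof -
    obtain s' t' h' where b: "b = (s', t', h')" by (cases b)
    have "h \<noteq> s'" "h \<noteq> t'" using disj[OF a(1)] that b by auto
    then show ?thesis by (auto simp: b axis_def)
  qed
  have "- (c $ h) = (\<Sum>b\<in>S. g b * (if snd (snd b) = h then 2 else 0))"
    by (simp add: c_eq coeff sum_negf[symmetric] if_distrib cong: if_cong)
  also have "\<dots> > 0"
    using a g by (intro sum_pos2[of _ "(s, t, h)"]) auto
  finally show ?thesis by auto
qed

lemma balanced_form_support:
  fixes S :: "'d::finite arrow set"
  assumes c: "c \<in> balanced_forms \<pi> S" and nz: "c $ r \<noteq> 0"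
  obtains s t h where "(s, t, h) \<in> S" "r \<in> {s, t, h}"
proof -
  obtain g where "c = (\<Sum>a\<in>S. g a *\<^sub>R arrow_form a)"
    using c by (auto simp: balanced_forms_def)
  with nz have "(\<Sum>a\<in>S. g a * arrow_form a $ r) \<noteq> 0" by simp
  then obtain a where "a \<in> S" "arrow_form a $ r \<noteq> 0"
    by (metis (no_types, lifting) mult_zero_right sum.neutral)
  then show thesis
    using that by (cases a) (auto simp: axis_def split: if_splits)
qed

text \<open>Every arrow form vanishes at \<open>y\<close> shifted by \<open>x \<circ> \<pi>\<close>, hence so does \<open>c\<close>; the shift
  contributes nothing by balance.\<close>

lemma balanced_form_vanishes:
  fixes S :: "'d::finite arrow set" and x :: "real^'n::finite"
  assumes c: "c \<in> balanced_forms \<pi> S"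
    and tie: "\<And>s t h. (s, t, h) \<in> S \<Longrightarrow>
      (y $ s + x $ \<pi> s) + (y $ t + x $ \<pi> t) = 2 * (y $ h + x $ \<pi> h)"
  shows "c \<bullet> y = 0"
proof -
  obtain g where c_eq: "c = (\<Sum>a\<in>S. g a *\<^sub>R arrow_form a)"
    and bal: "c \<bullet> (\<chi> r. x $ \<pi> r) = 0"
    using c unfolding balanced_forms_def by blast
  let ?u = "y + (\<chi> r. x $ \<pi> r)"
  have "arrow_form a \<bullet> ?u = 0" if "a \<in> S" for a
    using that tie by (cases a) (fastforce simp: inner_diff_left inner_add_left inner_axis')
  then have "c \<bullet> ?u = 0" by (simp add: c_eq inner_sum_left)
  with bal show ?thesis by (simp add: inner_add_right)
qed

section \<open>From circulations to balanced forms\<close>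

lemma sum_mset_out_edges:
  assumes "finite E"
  shows "(\<Sum>e\<in>#out_edges E v. \<gamma> e) = (\<Sum>e\<in>E. real (count (fst e) v) * \<gamma> e)"
  unfolding out_edges_def using assms by (induction E) auto

lemma sum_mset_eq_sum_count:
  fixes f :: "'n::finite \<Rightarrow> real"
  shows "(\<Sum>t\<in>#T. f t) = (\<Sum>v\<in>UNIV. f v * real (count T v))"
proof (induction T)
  case (add t T)
  have "(\<Sum>v\<in>UNIV. f v * real (count (add_mset t T) v))
      = (\<Sum>v\<in>UNIV. f v * real (count T v) + (if v = t then f v else 0))"
    by (intro sum.cong) (auto simp: algebra_simps)
  then show ?case using add by (simp add: sum.distrib)
qed simp

text \<open>Multiplying the conservation law at each vertex \<open>v\<close> by \<open>x v\<close>, adding up and exchanging the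
  sums over vertices and edges turns it into an identity between sums over edges.\<close>

lemma circulation_potential:
  fixes x :: "'n::finite \<Rightarrow> real"
  assumes circ: "circulation (UNIV, E) \<gamma>" and fin: "finite E"
  shows "(\<Sum>e\<in>E. \<gamma> e * (\<Sum>t\<in>#fst e. x t)) = (\<Sum>e\<in>E. \<gamma> e * (real (size (fst e)) * x (snd e)))"
proof -
  have law: "(\<Sum>e\<in>E. if snd e = v then real (size (fst e)) * \<gamma> e else 0)
      = (\<Sum>e\<in>E. real (count (fst e) v) * \<gamma> e)" for v
    using circ fin
    by (simp add: in_edges_def sum_mset_out_edges sum.inter_filter)
  have "(\<Sum>e\<in>E. \<gamma> e * (\<Sum>t\<in>#fst e. x t))
      = (\<Sum>e\<in>E. \<Sum>v\<in>UNIV. x v * (real (count (fst e) v) * \<gamma> e))"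
    by (simp add: sum_mset_eq_sum_count sum_distrib_left mult_ac)
  also have "\<dots> = (\<Sum>v\<in>UNIV. x v * (\<Sum>e\<in>E. real (count (fst e) v) * \<gamma> e))"
    by (subst sum.swap) (simp add: sum_distrib_left)
  also have "\<dots> = (\<Sum>v\<in>UNIV. \<Sum>e\<in>E.
      if snd e = v then x v * (real (size (fst e)) * \<gamma> e) else 0)"
    by (simp add: law[symmetric] sum_distrib_left if_distrib cong: if_cong)
  also have "\<dots> = (\<Sum>e\<in>E. \<gamma> e * (real (size (fst e)) * x (snd e)))"
    by (subst sum.swap) (simp add: mult_ac)
  finally show ?thesis .
qed

fun arrow_edge :: "('d \<Rightarrow> 'n) \<Rightarrow> 'd arrow \<Rightarrow> 'n hyperedge" where
  "arrow_edge \<pi> (s, t, h) = (if s = t then {#\<pi> s#} else {#\<pi> s, \<pi> t#}, \<pi> h)"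

lemma arrow_edge_size: "0 < size (fst (arrow_edge \<pi> a))"
  by (cases a) auto

text \<open>An edge with one tail becomes an arrow with that tail doubled.  The factor \<open>size\<close> turns this
  into a uniform rescaling by 2 of both sides of the conservation law.\<close>

lemma arrow_form_potential:
  fixes x :: "real^'n::finite" and a :: "'d::finite arrow" and \<pi> :: "'d \<Rightarrow> 'n"
  defines "e \<equiv> arrow_edge \<pi> a"
  shows "real (size (fst e)) * (arrow_form a \<bullet> (\<chi> r. x $ \<pi> r))
    = 2 * (\<Sum>t\<in>#fst e. x $ t) - 2 * (real (size (fst e)) * x $ snd e)"
  by (cases a) (auto simp: e_def inner_diff_left inner_add_left inner_axis')

lemma circulation_imp_balanced_form:
  fixes S :: "'d::finite arrow set" and E :: "'n::finite hyperedge set"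
  assumes circ: "circulation (UNIV, E) \<gamma>" and E: "E \<subseteq> arrow_edge \<pi> ` S"
  shows "balanced_forms \<pi> S \<noteq> {}"
proof -
  \<comment> \<open>Several arrows may represent one edge; only one of them is to carry its weight.\<close>
  obtain R where R: "R \<subseteq> S" "inj_on (arrow_edge \<pi>) R" "E = arrow_edge \<pi> ` R"
    using E by (auto simp: subset_image_inj)
  have fin: "finite E" using R(3) by simp
  have nonneg: "\<gamma> (arrow_edge \<pi> a) \<ge> 0" if "a \<in> R" for a
    using circ R(3) that by auto
  define w where "w e = real (size (fst e)) * \<gamma> e" for e :: "'n hyperedge"
  define g where "g a = (if a \<in> R then w (arrow_edge \<pi> a) else 0)" for a
  let ?c = "\<Sum>a\<in>S. g a *\<^sub>R arrow_form a"
  have "\<exists>e\<in>E. \<gamma> e \<noteq> 0"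
    using circ by (auto intro: ccontr dest: sum.neutral)
  then obtain a where "a \<in> R" "\<gamma> (arrow_edge \<pi> a) \<noteq> 0" using R(3) by auto
  then have "\<exists>a\<in>S. 0 < g a"
    using nonneg[of a] R(1) arrow_edge_size[of \<pi> a] by (intro bexI[of _ a]) (auto simp: g_def w_def)
  moreover have "\<forall>a\<in>S. 0 \<le> g a"
    using nonneg by (auto simp: g_def w_def)
  moreover have "?c \<bullet> (\<chi> r. x $ \<pi> r) = 0" for x :: "real^'n"
  proof -
    let ?f = "\<lambda>e. 2 * (\<Sum>t\<in>#fst e. x $ t) - 2 * (real (size (fst e)) * x $ snd e)"
    have "?c \<bullet> (\<chi> r. x $ \<pi> r) = (\<Sum>a\<in>S. g a * (arrow_form a \<bullet> (\<chi> r. x $ \<pi> r)))"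
      by (simp add: inner_sum_left)
    also have "\<dots> = (\<Sum>a\<in>R. g a * (arrow_form a \<bullet> (\<chi> r. x $ \<pi> r)))"
      using R(1) by (intro sum.mono_neutral_right) (auto simp: g_def)
    also have "\<dots> = (\<Sum>a\<in>R. \<gamma> (arrow_edge \<pi> a) * ?f (arrow_edge \<pi> a))"
      by (intro sum.cong refl, subst arrow_form_potential[symmetric])
         (simp add: g_def w_def mult_ac)
    also have "\<dots> = (\<Sum>e\<in>E. \<gamma> e * ?f e)"
      unfolding R(3) by (subst sum.reindex[OF R(2)]) simp
    also have "\<dots> = 2 * (\<Sum>e\<in>E. \<gamma> e * (\<Sum>t\<in>#fst e. x $ t))
        - 2 * (\<Sum>e\<in>E. \<gamma> e * (real (size (fst e)) * x $ snd e))"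
      by (simp add: sum_subtractf sum_distrib_left right_diff_distrib mult_ac)
    also have "\<dots> = 0"
      using circulation_potential[OF circ fin, of "\<lambda>v. x $ v"] by simp
    finally show ?thesis .
  qed
  ultimately have "?c \<in> balanced_forms \<pi> S"
    unfolding balanced_forms_def by blast
  then show ?thesis by blast
qed

section \<open>The arrows of a tropical hypergraph\<close>

definition entry :: "'n \<Rightarrow> 'm \<Rightarrow> 'm \<Rightarrow> ('n, 'm::linorder) sym_index" where
  "entry k i j = Abs_sym_index (k, i, j)"

definition slice :: "('n, 'm::linorder) sym_index \<Rightarrow> 'n" where
  "slice r = fst (Rep_sym_index r)"

lemma Rep_entry: "i \<le> j \<Longrightarrow> Rep_sym_index (entry k i j) = (k, i, j)"
  by (simp add: entry_def Abs_sym_index_inverse)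

lemma slice_entry [simp]: "i \<le> j \<Longrightarrow> slice (entry k i j) = k"
  by (simp add: slice_def Rep_entry)

lemma entry_eq_iff:
  "i \<le> j \<Longrightarrow> i' \<le> j' \<Longrightarrow> entry k i j = entry k' i' j' \<longleftrightarrow> k = k' \<and> i = i' \<and> j = j'"
  by (metis Rep_entry prod.inject)

lemma moduli_entry: "i \<le> j \<Longrightarrow> moduli Q $ entry k i j = modulus (Q k $ i $ j)"
  by (simp add: moduli_def Rep_entry)

definition tropical_arrows ::
  "('n::finite \<Rightarrow> (signed_trop, 'm::{finite,linorder}) sq_matrix) \<Rightarrow> real^'n
     \<Rightarrow> ('n, 'm) sym_index arrow set" where
  "tropical_arrows Q x =
     {(entry k i i, entry k i i, entry l i i) | i k l. Qpos Q x i = Qneg Q x i \<and>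
        k \<in> argQpos Q x i \<and> l \<in> argQneg Q x i} \<union>
     {(entry k1 i i, entry k2 j j, entry l i j) | i j k1 k2 l. i < j \<and>
        Qpos Q x i + Qpos Q x j = 2 * Qoff Q x i j \<and>
        k1 \<in> argQpos Q x i \<and> k2 \<in> argQpos Q x j \<and> l \<in> argQoff Q x i j}"

lemma tropical_edges_subset_arrow_edges:
  "tropical_edges Q x \<subseteq> arrow_edge slice ` tropical_arrows Q x"
proof
  fix e assume "e \<in> tropical_edges Q x"
  then consider
    i k l where "e = ({#k#}, l)" "Qpos Q x i = Qneg Q x i" "k \<in> argQpos Q x i" "l \<in> argQneg Q x i"
  | i j k1 k2 l where "e = ({#k1, k2#}, l)" "i < j" "Qpos Q x i + Qpos Q x j = 2 * Qoff Q x i j"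
      "k1 \<in> argQpos Q x i" "k2 \<in> argQpos Q x j" "l \<in> argQoff Q x i j"
    unfolding tropical_edges_def by blast
  then show "e \<in> arrow_edge slice ` tropical_arrows Q x"
  proof cases
    case (1 i k l)
    then show ?thesis
      by (intro image_eqI[of _ _ "(entry k i i, entry k i i, entry l i i)"])
         (auto simp: tropical_arrows_def)
  next
    case (2 i j k1 k2 l)
    then have "(entry k1 i i, entry k2 j j, entry l i j) \<in> tropical_arrows Q x"
      unfolding tropical_arrows_def by blast
    with 2 show ?thesis
      by (intro image_eqI[of _ _ "(entry k1 i i, entry k2 j j, entry l i j)"])
         (auto simp: entry_eq_iff)
  qed
qed

text \<open>Tails are positive diagonal entries, heads are negative diagonal or off-diagonal ones.\<close>

lemma tropical_arrows_heads_not_tails: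
  assumes "(s, t, h) \<in> tropical_arrows Q x" "(s', t', h') \<in> tropical_arrows Q x"
  shows "h \<noteq> s' \<and> h \<noteq> t'"
proof -
  let ?T = "{entry k i i | k i. k \<in> pos_ind Q i}"
  let ?H = "{entry k i j | k i j. i < j \<or> i = j \<and> k \<in> neg_ind Q i}"
  have "h \<in> ?H" "s' \<in> ?T" "t' \<in> ?T"
    using assms unfolding tropical_arrows_def maximizers_over_def by blast+
  moreover have "?H \<inter> ?T = {}"
    by (force simp: entry_eq_iff pos_ind_def neg_ind_def trop_pos_def trop_neg_def)
  ultimately show ?thesis by blast
qed

lemma maximizer_value:
  assumes "k \<in> maximizers_over Q x K i j" "Q k $ i $ j \<noteq> TZero" "i \<le> j"
  shows "max_over Q x K i j = ereal (finite_part (moduli Q) $ entry k i j + x $ k)"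
    and "entry k i j \<in> trop_support (moduli Q)"
  using assms
  by (cases "Q k $ i $ j"; force simp: maximizers_over_def finite_part_def moduli_entry
        trop_support_def)+

text \<open>The two conclusions belong together, as both rest on the fact that a maximizer selects a
  finite entry.\<close>

lemma tropical_arrow_tie:
  fixes Q :: "'n::finite \<Rightarrow> (signed_trop, 'm::{finite,linorder}) sq_matrix"
  defines "y \<equiv> finite_part (moduli Q)"
  assumes a: "(s, t, h) \<in> tropical_arrows Q x"
  shows "(y $ s + x $ slice s) + (y $ t + x $ slice t) = 2 * (y $ h + x $ slice h)"
    and "{s, t, h} \<subseteq> trop_support (moduli Q)"
proof -
  have pos: "max_over Q x (pos_ind Q i) i i = ereal (y $ entry k i i + x $ k)"
    "entry k i i \<in> trop_support (moduli Q)" if "k \<in> argQpos Q x i" for k i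
    using maximizer_value[OF that] that unfolding y_def
    by (auto simp: maximizers_over_def pos_ind_def trop_pos_def)
  have neg: "max_over Q x (neg_ind Q i) i i = ereal (y $ entry k i i + x $ k)"
    "entry k i i \<in> trop_support (moduli Q)" if "k \<in> argQneg Q x i" for k i
    using maximizer_value[OF that] that unfolding y_def
    by (auto simp: maximizers_over_def neg_ind_def trop_neg_def)
  have off: "max_over Q x (off_ind Q i j) i j = ereal (y $ entry k i j + x $ k)"
    "entry k i j \<in> trop_support (moduli Q)" if "k \<in> argQoff Q x i j" "i < j" for k i j
    using maximizer_value[OF that(1)] that unfolding y_def
    by (auto simp: maximizers_over_def off_ind_def)
  from a consider
    i k l where "s = entry k i i" "t = entry k i i" "h = entry l i i"
      "Qpos Q x i = Qneg Q x i" "k \<in> argQpos Q x i" "l \<in> argQneg Q x i"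
  | i j k1 k2 l where "s = entry k1 i i" "t = entry k2 j j" "h = entry l i j" "i < j"
      "Qpos Q x i + Qpos Q x j = 2 * Qoff Q x i j"
      "k1 \<in> argQpos Q x i" "k2 \<in> argQpos Q x j" "l \<in> argQoff Q x i j"
    unfolding tropical_arrows_def by blast
  then have "(y $ s + x $ slice s) + (y $ t + x $ slice t) = 2 * (y $ h + x $ slice h)
      \<and> {s, t, h} \<subseteq> trop_support (moduli Q)"
  proof cases
    case (1 i k l)
    then show ?thesis using pos neg by auto
  next
    case (2 i j k1 k2 l)
    have "ereal ((y $ s + x $ k1) + (y $ t + x $ k2)) = 2 * ereal (y $ h + x $ l)"
      using 2 pos(1)[OF 2(6)] pos(1)[OF 2(7)] off(1)[OF 2(8) 2(4)] by simp
    also have "\<dots> = ereal (2 * (y $ h + x $ l))"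
      by (metis numeral_eq_ereal times_ereal.simps(1))
    finally show ?thesis
      using 2 pos(2)[OF 2(6)] pos(2)[OF 2(7)] off(2)[OF 2(8) 2(4)] by simp
  qed
  then show "(y $ s + x $ slice s) + (y $ t + x $ slice t) = 2 * (y $ h + x $ slice h)"
    and "{s, t, h} \<subseteq> trop_support (moduli Q)" by blast+
qed

section \<open>The exceptional set\<close>

text \<open>One form is chosen for each set of arrows, because a set of arrows may have infinitely many
  balanced forms while there are only finitely many sets of arrows.  Zero, which can be chosen only
  for sets of arrows that no circulation produces, would contribute all of a stratum.\<close>

definition chosen_forms :: "(real^('n::finite, 'm::{finite,linorder}) sym_index) set" where
  "chosen_forms = range (\<lambda>S :: ('n, 'm) sym_index arrow set.
     SOME c. c \<in> balanced_forms slice S) - {0}"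

lemma finite_chosen_forms: "finite chosen_forms"
  by (simp add: chosen_forms_def)

lemma circulation_imp_moduli_in_trop_zeros:
  assumes "circulation (tropical_hypergraph Q x) \<gamma>"
  shows "moduli Q \<in> trop_zeros chosen_forms"
proof -
  let ?S = "tropical_arrows Q x"
  define c where "c = (SOME c. c \<in> balanced_forms slice ?S)"
  have "balanced_forms slice ?S \<noteq> {}"
    using circulation_imp_balanced_form[OF _ tropical_edges_subset_arrow_edges]
      assms[unfolded tropical_hypergraph_def] by blast
  then have c: "c \<in> balanced_forms slice ?S"
    unfolding c_def by (simp add: some_in_eq)
  have "c \<noteq> 0"
    by (rule balanced_form_nonzero[OF c tropical_arrows_heads_not_tails])
  then have "c \<in> chosen_forms"
    by (auto simp: chosen_forms_def c_def)
  moreover have "r \<in> trop_support (moduli Q)" if "c $ r \<noteq> 0" for r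
    by (rule balanced_form_support[OF c that]) (use tropical_arrow_tie(2) in blast)
  moreover have "c \<bullet> finite_part (moduli Q) = 0"
    by (rule balanced_form_vanishes[OF c tropical_arrow_tie(1)])
  moreover have "moduli Q $ r \<in> trop" for r
  proof -
    have "modulus q \<noteq> \<infinity>" for q by (cases q) auto
    then show ?thesis by (auto simp: moduli_def trop_def split: prod.split)
  qed
  ultimately show ?thesis
    by (auto simp: trop_zeros_def)
qed

theorem lemma5p23:
  "\<exists>X :: (ereal ^ ('n::finite, 'm::{finite,linorder}) sym_index) set.
     (\<forall>z\<in>X. \<forall>r. z $ r \<in> trop) \<and>
     (\<forall>D. D \<noteq> {} \<longrightarrow>
        (\<exists>\<H>. finite \<H> \<and> (\<forall>H\<in>\<H>. hyperplane_of D H) \<and> stratum X D = \<Union>\<H>)) \<and>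
     (\<forall>Q :: 'n \<Rightarrow> (signed_trop, 'm) sq_matrix.
        (\<forall>k. transpose (Q k) = Q k \<and> tropical_metzler (Q k)) \<longrightarrow>
        moduli Q \<notin> X \<longrightarrow>
        (\<forall>x :: real^'n. \<not> (\<exists>\<gamma>. circulation (tropical_hypergraph Q x) \<gamma>)))"
proof (intro exI[of _ "trop_zeros chosen_forms"] conjI allI impI ballI)
  show "z $ r \<in> trop" if "z \<in> trop_zeros chosen_forms"
    for z :: "ereal^('n, 'm) sym_index" and r
    using that by (simp add: trop_zeros_def)
  show "\<exists>\<H>. finite \<H> \<and> (\<forall>H\<in>\<H>. hyperplane_of D H) \<and>
      stratum (trop_zeros chosen_forms) D = \<Union>\<H>" for D :: "('n, 'm) sym_index set"
    by (rule stratum_trop_zeros_hyperplanes[OF finite_chosen_forms])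
       (simp add: chosen_forms_def)
  show "\<not> (\<exists>\<gamma>. circulation (tropical_hypergraph Q x) \<gamma>)"
    if "moduli Q \<notin> trop_zeros chosen_forms"
    for Q :: "'n \<Rightarrow> (signed_trop, 'm) sq_matrix" and x
    using that circulation_imp_moduli_in_trop_zeros by blast
qed

end
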